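(* Let $K$ be an algebraically closed field and $m\geq 4$. Let $g_l=x^{m-1-l}(1+x^l)=x^{m-1-l}+x^{m-1}$ where $1\leq l\leq m-3$, and $A_l=K+\sum_{i\geq 1}Kg_l^i+x^mK[x]$. Then $A_l\in\mathcal{A}(m)$ and $A_l\neq K+x^mK[x]$ iff $m-1-l\nmid m-1$. If these equivalent conditions hold then: 1. $A_l=K\oplus Kg_l\oplus\bigoplus_{2\leq i<\frac{m-1}{m-1-l}}K(g_l^i)_{<m}\oplus x^mK[x]$ and $\Gamma_{A_l}=\{i(m-1-l)\mid 1\leq i<\frac{m-1}{m-1-l}\}$. 2. $\{1,g_l,x^{i(m-1-l)}\mid 2\leq i<\frac{m-1}{m-1-l}\}$ is the canonical basis of the algebra $\overline{A_l}=A_l/x^mK[x]$. 3. $\operatorname{Aut}_K(A_l)=\langle t_{\lambda_l}\rangle$ if $\operatorname{char}(K)=0$, and $\operatorname{Aut}_K(A_l)=\langle t_{\lambda_{l_p}}\rangle$ if $\operatorname{char}(K)=p>0$.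
   Context: $\mathcal{A}(m)$ is the set of all $K$-subalgebras $A$ of $K[x]$ such that $x^mK[x]\subset A$ and $x^{m-1}\notin A$. For $A\in\mathcal{A}(m)$, $\Gamma_A$ is the set of integers $\gamma$ with $1\leq\gamma\leq m-1$ such that $A$ contains an element of the form $x^\gamma+\sum_{j>\gamma}\lambda_jx^j$. With $\Gamma=\Gamma_A$, the algebra $\overline{A}:=A/x^mK[x]\subseteq K[x]/x^mK[x]=\bigoplus_{i=0}^{m-1}Kx^i$ has a unique $K$-basis $\{1,f_\gamma\mid\gamma\in\Gamma\}$ (the canonical basis) with $f_\gamma=x^\gamma+\sum_{\delta}\lambda_{\gamma\delta}x^\delta$, $\lambda_{\gamma\delta}\in K$, the sum being over $\delta\notin\Gamma$, $\gamma<\delta\leq m-1$. For $p\in K[x]$, $p_{<m}$ is the unique polynomial of degree $<m$ with $p\equiv p_{<m}\mod(x^m)$. For a prime $p$ and $l\geq 1$, $l_p$ is the $p$-co-prime divisor of $l$: $l=p^kl_p$, $p\nmid l_p$. $t_\lambda$ denotes the automorphism $x\mapsto\lambda x$ of $K[x]$ ($\lambda\in K^\times$), identified with its restriction to $A$ when $t_\lambda(A)=A$; $\lambda_n$ is a primitive $n$-th root of unity in $K$. $\operatorname{Aut}_K(A)$ is the group of $K$-algebra automorphisms of $A$. *)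

theory Defs
  imports
    Complex_Main
    "HOL-Computational_Algebra.Computational_Algebra"
    "HOL-Library.Set_Algebras"
    "HOL-Algebra.Bij"
    "HOL-Algebra.Generated_Groups"
begin

text \<open>The ground field \<open>K\<close> is the type \<open>'a\<close> and \<open>K[x]\<close> is \<open>'a poly\<close>.\<close>

interpretation poly_space: vector_space "smult :: 'a::field \<Rightarrow> 'a poly \<Rightarrow> 'a poly"
  by unfold_locales (simp_all add: smult_add_right smult_add_left)

definition const_polys :: "'a::field poly set" where
  "const_polys = range (\<lambda>c. [:c:])"

definition line :: "'a::field poly \<Rightarrow> 'a poly set" where
  "line v = range (\<lambda>c. smult c v)"

definition xpow_ideal :: "nat \<Rightarrow> 'a::field poly set" where
  "xpow_ideal m = range (\<lambda>q. monom 1 m * q)"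

definition poly_subalgebra :: "'a::field poly set \<Rightarrow> bool" where
  "poly_subalgebra A \<longleftrightarrow>
     poly_space.subspace A \<and> 1 \<in> A \<and> (\<forall>p\<in>A. \<forall>q\<in>A. p * q \<in> A)"

definition \<A> :: "nat \<Rightarrow> 'a::field poly set set" where
  "\<A> m = {A. poly_subalgebra A \<and> xpow_ideal m \<subseteq> A \<and> monom 1 (m - 1) \<notin> A}"

text \<open>The polynomials of the form \<open>x\<^sup>\<gamma> + (\<Sum>j>\<gamma>. \<lambda>\<^sub>j x\<^sup>j)\<close> are those whose lowest nonzero
  coefficient is a 1 in degree \<open>\<gamma>\<close>.\<close>

definition Gam :: "nat \<Rightarrow> 'a::field poly set \<Rightarrow> nat set" where
  "Gam m A = {\<gamma>. 1 \<le> \<gamma> \<and> \<gamma> \<le> m - 1 \<and>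
                 (\<exists>p\<in>A. coeff p \<gamma> = 1 \<and> (\<forall>j<\<gamma>. coeff p j = 0))}"

definition trunc :: "nat \<Rightarrow> 'a::field poly \<Rightarrow> 'a poly" where
  "trunc m p = p mod monom 1 m"

text \<open>The quotient of \<open>K[x]\<close> by \<open>x\<^sup>m K[x]\<close> is identified with the space of polynomials of degree
  less than \<open>m\<close>, each residue class being represented by its remainder. So the quotient of \<open>A\<close>
  is the space of remainders of elements of \<open>A\<close>.\<close>

definition quot_alg :: "nat \<Rightarrow> 'a::field poly set \<Rightarrow> 'a poly set" where
  "quot_alg m A = trunc m ` A"

definition is_basis_of :: "'a::field poly set \<Rightarrow> 'a poly set \<Rightarrow> bool" where
  "is_basis_of B V \<longleftrightarrow> poly_space.independent B \<and> poly_space.span B = V"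

definition is_canonical_basis :: "nat \<Rightarrow> 'a::field poly set \<Rightarrow> 'a poly set \<Rightarrow> bool" where
  "is_canonical_basis m A B \<longleftrightarrow>
     is_basis_of B (quot_alg m A) \<and>
     (\<exists>f a. B = insert 1 (f ` Gam m A) \<and>
        (\<forall>\<gamma>\<in>Gam m A. f \<gamma> = monom 1 \<gamma> +
            (\<Sum>\<delta>\<in>{\<delta>. \<delta> \<notin> Gam m A \<and> \<gamma> < \<delta> \<and> \<delta> \<le> m - 1}. smult (a \<gamma> \<delta>) (monom 1 \<delta>))))"

text \<open>\<open>A\<close> is the internal direct sum of the listed subspaces: each element of \<open>A\<close> is in exactly one
  way a sum of one element from each.\<close>

definition is_direct_sum :: "'a::field poly set \<Rightarrow> 'a poly set list \<Rightarrow> bool" where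
  "is_direct_sum A Vs \<longleftrightarrow>
     (\<forall>V\<in>set Vs. poly_space.subspace V) \<and> bij_betw sum_list (listset Vs) A"

text \<open>Maps on \<open>A\<close> are represented by functions that are extensional on \<open>A\<close>, as in
  \<^const>\<open>AutoGroup\<close>.\<close>

definition alg_auto :: "'a::field poly set \<Rightarrow> ('a poly \<Rightarrow> 'a poly) set" where
  "alg_auto A = {\<phi> \<in> Bij A. \<phi> 1 = 1 \<and>
     (\<forall>p\<in>A. \<forall>q\<in>A. \<phi> (p + q) = \<phi> p + \<phi> q \<and> \<phi> (p * q) = \<phi> p * \<phi> q) \<and>
     (\<forall>c. \<forall>p\<in>A. \<phi> (smult c p) = smult c (\<phi> p))}"

definition AlgAutoGroup :: "'a::field poly set \<Rightarrow> ('a poly \<Rightarrow> 'a poly) monoid" where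
  "AlgAutoGroup A = BijGroup A \<lparr>carrier := alg_auto A\<rparr>"

lemma group_AlgAutoGroup:
  assumes "poly_subalgebra A"
  shows "group (AlgAutoGroup A)"
proof -
  have closed: "p + q \<in> A" "p * q \<in> A" "smult c p \<in> A" "1 \<in> A"
    if "p \<in> A" "q \<in> A" for p q c
    using assms that unfolding poly_subalgebra_def
    by (auto intro: poly_space.subspace_add poly_space.subspace_scale)
  have one: "1 \<in> A"
    using assms by (simp add: poly_subalgebra_def)
  have "subgroup (alg_auto A) (BijGroup A)"
  proof (rule group.subgroupI[OF group_BijGroup])
    show "alg_auto A \<subseteq> carrier (BijGroup A)"
      by (auto simp: alg_auto_def BijGroup_def)
    have "(\<lambda>x\<in>A. x) \<in> alg_auto A"
      using closed one by (simp add: alg_auto_def id_Bij)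
    then show "alg_auto A \<noteq> {}"
      by blast
  next
    fix \<phi> assume "\<phi> \<in> alg_auto A"
    then have B: "\<phi> \<in> Bij A" and H: "\<phi> 1 = 1"
      "\<And>p q. p \<in> A \<Longrightarrow> q \<in> A \<Longrightarrow> \<phi> (p + q) = \<phi> p + \<phi> q"
      "\<And>p q. p \<in> A \<Longrightarrow> q \<in> A \<Longrightarrow> \<phi> (p * q) = \<phi> p * \<phi> q"
      "\<And>c p. p \<in> A \<Longrightarrow> \<phi> (smult c p) = smult c (\<phi> p)"
      by (auto simp: alg_auto_def)
    from B have bij: "bij_betw \<phi> A A"
      by (simp add: Bij_def)
    define \<psi> where "\<psi> = inv_into A \<phi>"
    have in_A: "\<psi> p \<in> A" and right: "\<phi> (\<psi> p) = p" if "p \<in> A" for p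
      using bij that unfolding \<psi>_def bij_betw_def by (auto simp: inv_into_into f_inv_into_f)
    have eqI: "\<psi> p = q" if "q \<in> A" "\<phi> q = p" for p q
      using bij that unfolding \<psi>_def bij_betw_def by (auto intro: inv_into_f_eq)
    have "restrict \<psi> A \<in> alg_auto A"
      unfolding alg_auto_def
      using restrict_inv_into_Bij[OF B]
      by (auto simp: \<psi>_def[symmetric] closed one H in_A right intro!: eqI)
    then show "inv\<^bsub>BijGroup A\<^esub> \<phi> \<in> alg_auto A"
      using inv_BijGroup[OF B] by (simp add: \<psi>_def)
  next
    fix \<phi> \<psi> assume a: "\<phi> \<in> alg_auto A" "\<psi> \<in> alg_auto A"
    then have B: "\<phi> \<in> Bij A" "\<psi> \<in> Bij A"
      by (auto simp: alg_auto_def)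
    have \<psi>A: "\<psi> p \<in> A" if "p \<in> A" for p
      using Bij_imp_funcset[OF B(2)] that by auto
    have "compose A \<phi> \<psi> \<in> alg_auto A"
      using a compose_Bij[OF B] by (auto simp: alg_auto_def compose_def closed one \<psi>A)
    then show "\<phi> \<otimes>\<^bsub>BijGroup A\<^esub> \<psi> \<in> alg_auto A"
      using B by (simp add: BijGroup_def)
  qed
  then show ?thesis
    unfolding AlgAutoGroup_def
    using group.subgroup_imp_group group_BijGroup by blast
qed

definition dilation :: "'a::field \<Rightarrow> 'a poly \<Rightarrow> 'a poly" where
  "dilation \<mu> p = pcompose p [:0, \<mu>:]"

definition is_primitive_root :: "nat \<Rightarrow> 'a::field \<Rightarrow> bool" where
  "is_primitive_root n \<mu> \<longleftrightarrow> n > 0 \<and> \<mu> ^ n = 1 \<and> (\<forall>k. 0 < k \<and> k < n \<longrightarrow> \<mu> ^ k \<noteq> 1)"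

text \<open>If \<open>dilation \<mu>\<close> does not map \<open>A\<close> onto \<open>A\<close>, then the right-hand side of the second conjunct is not
  contained in \<^term>\<open>alg_auto A\<close>; thus the equation includes \<open>dilation \<mu> ` A = A\<close>. The first conjunct
  keeps the second one from being vacuous.\<close>

definition Aut_generated_by_root :: "'a::field poly set \<Rightarrow> nat \<Rightarrow> bool" where
  "Aut_generated_by_root A n \<longleftrightarrow>
     (\<exists>\<mu>::'a. is_primitive_root n \<mu>) \<and>
     (\<forall>\<mu>::'a. is_primitive_root n \<mu> \<longrightarrow>
        carrier (AlgAutoGroup A) = generate (AlgAutoGroup A) {restrict (dilation \<mu>) A})"

definition coprime_part :: "nat \<Rightarrow> nat \<Rightarrow> nat" where
  "coprime_part p l = l div p ^ multiplicity p l"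

lemma coprime_part:
  assumes "prime p" "l \<ge> 1"
  shows "l = p ^ multiplicity p l * coprime_part p l" "\<not> p dvd coprime_part p l"
proof -
  have "l \<noteq> 0" "\<not> is_unit p"
    using assms by auto
  then show "l = p ^ multiplicity p l * coprime_part p l" "\<not> p dvd coprime_part p l"
    unfolding coprime_part_def
    by (auto simp: multiplicity_dvd multiplicity_decompose)
qed

definition gl :: "nat \<Rightarrow> nat \<Rightarrow> 'a::field poly" where
  "gl m l = monom 1 (m - 1 - l) * (1 + monom 1 l)"

definition Al :: "nat \<Rightarrow> nat \<Rightarrow> 'a::field poly set" where
  "Al m l = const_polys + poly_space.span {gl m l ^ i | i. i \<ge> 1} + xpow_ideal m"

end

theory Submission
  imports Defs
begin

text \<open>Write \<open>n = m - 1 - l\<close>, so \<open>g\<^sub>l = x\<^sup>n + x\<^sup>m\<^sup>-\<^sup>1\<close> and \<open>g\<^sub>l\<^sup>i \<equiv> x\<^sup>n\<^sup>i\<close> modulo \<open>x\<^sup>m\<close> for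
  \<open>i \<ge> 2\<close>. If \<open>n\<close> does not divide \<open>m - 1\<close>, then \<open>A\<^sub>l\<close> consists of the polynomials whose
  coefficients in degrees \<open>n\<close> and \<open>m - 1\<close> agree and whose other coefficients below \<open>m - 1\<close> vanish
  outside the multiples of \<open>n\<close>; the first two claims are read off from this description.
  An automorphism of an algebra in \<open>\<A>(m)\<close> extends to \<open>K[x]\<close>, hence is \<open>x \<mapsto> ax + b\<close>, and \<open>b = 0\<close>
  because it preserves the conductor \<open>x\<^sup>m K[x]\<close>. Such a dilation maps \<open>A\<^sub>l\<close> to itself iff
  \<open>a\<^sup>n = a\<^sup>m\<^sup>-\<^sup>1\<close>, that is, iff \<open>a\<^sup>l = 1\<close>.\<close>

section \<open>Roots of unity\<close>

lemma is_primitive_root_power_eq_1_iff: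
  assumes "is_primitive_root n (z :: 'a::field)"
  shows "z ^ k = 1 \<longleftrightarrow> n dvd k"
proof -
  have n: "n > 0" "z ^ n = 1" "\<And>j. 0 < j \<Longrightarrow> j < n \<Longrightarrow> z ^ j \<noteq> 1"
    using assms by (auto simp: is_primitive_root_def)
  have "z ^ k = z ^ (n * (k div n) + k mod n)"
    by simp
  also have "\<dots> = z ^ (k mod n)"
    unfolding power_add power_mult n(2) by simp
  finally have "z ^ k = z ^ (k mod n)" .
  then show ?thesis
    using n(3)[of "k mod n"] n(1) by (auto simp: dvd_eq_mod_eq_0)
qed

lemma ex_is_primitive_root_of_root:
  assumes "(z :: 'a::field) ^ n = 1" "n > 0"
  obtains d where "d dvd n" "is_primitive_root d z"
proof -
  define d where "d = (LEAST d. d > 0 \<and> z ^ d = 1)"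
  have d: "d > 0 \<and> z ^ d = 1"
    unfolding d_def by (rule LeastI[of _ n]) (use assms in auto)
  moreover have "z ^ k \<noteq> 1" if "0 < k" "k < d" for k
    using not_less_Least[of k "\<lambda>d. d > 0 \<and> z ^ d = 1"] that by (auto simp: d_def)
  ultimately have "is_primitive_root d z"
    by (auto simp: is_primitive_root_def)
  with assms that show ?thesis
    using is_primitive_root_power_eq_1_iff by blast
qed

text \<open>Raising \<open>(y * z) ^ k = 1\<close> to the power \<open>a\<close> removes
  \<open>y\<close> and leaves \<open>z ^ (k * a) = 1\<close>, so \<open>b\<close> divides
  \<open>k * a\<close> and, by coprimality, \<open>k\<close>. The symmetric argument gives
  \<open>a dvd k\<close>.\<close>

lemma is_primitive_root_mult:
  assumes "is_primitive_root a (y :: 'a::field)" "is_primitive_root b z" "coprime a b"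
  shows "is_primitive_root (a * b) (y * z)"
proof -
  have pos: "a > 0" "b > 0"
    using assms by (auto simp: is_primitive_root_def)
  have "a * b dvd k" if k: "(y * z) ^ k = 1" for k
  proof -
    have yk: "y ^ (k * a) = 1" "z ^ (k * b) = 1"
      using assms by (auto simp: is_primitive_root_power_eq_1_iff)
    have "(y * z) ^ (k * a) = 1" "(y * z) ^ (k * b) = 1"
      by (simp_all add: power_mult k)
    then have "z ^ (k * a) = 1" "y ^ (k * b) = 1"
      using yk by (simp_all add: power_mult_distrib)
    then have "b dvd k * a" "a dvd k * b"
      using assms by (simp_all add: is_primitive_root_power_eq_1_iff)
    then have "b dvd k" "a dvd k"
      using assms(3) by (simp_all add: coprime_dvd_mult_left_iff coprime_commute)
    then show ?thesis
      using assms(3) by (simp add: divides_mult)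
  qed
  moreover have "y ^ (a * b) = 1" "z ^ (a * b) = 1"
    using assms(1,2) by (simp_all add: is_primitive_root_power_eq_1_iff)
  then have "(y * z) ^ (a * b) = 1"
    by (simp add: power_mult_distrib)
  ultimately show ?thesis
    using pos unfolding is_primitive_root_def by (metis nat_0_less_mult_iff nat_dvd_not_less)
qed

text \<open>A root of 1 + X + ... + X^(q-1) is a q-th root of unity, and it differs from 1 because
  the sum takes the nonzero value q at 1. Primality leaves \<open>q\<close> as its only possible
  order.\<close>

lemma ex_is_primitive_root_prime:
  assumes "prime q" "of_nat q \<noteq> (0 :: 'a::alg_closed_field)"
  shows "\<exists>z::'a. is_primitive_root q z"
proof -
  have q: "q > 1" "{..q - 1} = {..<q}"
    using prime_gt_1_nat[OF assms(1)] by auto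
  obtain z :: 'a where z: "(\<Sum>k<q. z ^ k) = 0"
    using alg_closed[of "q - 1" "\<lambda>_. 1 :: 'a"] q by auto
  have "z ^ q - 1 = (z - 1) * (\<Sum>k<q. z ^ k)"
    by (rule power_diff_1_eq)
  then have "z ^ q = 1"
    using z by simp
  then obtain d where d: "d dvd q" "is_primitive_root d z"
    using q by (auto elim: ex_is_primitive_root_of_root)
  have "z \<noteq> 1"
    using z assms(2) by auto
  then have "d \<noteq> 1"
    using d(2) by (auto simp: is_primitive_root_def)
  then show ?thesis
    using d assms(1) by (metis prime_nat_iff)
qed

text \<open>The root is built one prime factor at a time: a new prime \<open>q\<close> contributes
  an independent factor of order \<open>q\<close>, while a repeated prime is handled by extracting a
  q-th root of the root already found.\<close>

lemma ex_is_primitive_root: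
  assumes "of_nat n \<noteq> (0 :: 'a::alg_closed_field)"
  shows "\<exists>z::'a. is_primitive_root n z"
  using assms
proof (induction n rule: prime_divisors_induct)
  case zero
  then show ?case by simp
next
  case (unit n)
  then have "is_primitive_root n (1 :: 'a)"
    by (auto simp: is_primitive_root_def)
  then show ?case by blast
next
  case (factor q n)
  from factor.prems have nz: "of_nat q \<noteq> (0 :: 'a)" "of_nat n \<noteq> (0 :: 'a)"
    by auto
  obtain y :: 'a where y: "is_primitive_root n y"
    using factor.IH nz by blast
  have n: "n > 0" "q > 1"
    using y prime_gt_1_nat[OF \<open>prime q\<close>] by (auto simp: is_primitive_root_def)
  show ?case
  proof (cases "q dvd n")
    case False
    obtain x :: 'a where "is_primitive_root q x"
      using ex_is_primitive_root_prime[OF \<open>prime q\<close> nz(1)] by blast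
    with y show ?thesis
      using is_primitive_root_mult prime_imp_coprime[OF \<open>prime q\<close> False] by blast
  next
    case True
    then obtain n' where n': "n = q * n'" by blast
    obtain z where z: "z ^ q = y"
      using nth_root_exists[of q y] n by auto
    have "z ^ (q * n) = 1"
      using y z by (simp add: power_mult is_primitive_root_def)
    then obtain d where d: "d dvd q * n" "is_primitive_root d z"
      using n by (auto elim: ex_is_primitive_root_of_root)
    \<comment> \<open>The order \<open>d\<close> of \<open>z\<close> turns out to be
      \<open>n * e\<close> with \<open>e dvd q\<close>. The value \<open>e = 1\<close> is excluded
      by \<open>q dvd n\<close>: otherwise y^(n/q) = z^n = 1, against the order of
      \<open>y\<close>.\<close>
    have "y ^ d = (z ^ d) ^ q"
      by (simp flip: z power_mult add: mult.commute)
    then have "y ^ d = 1"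
      using d(2) by (simp add: is_primitive_root_def)
    then have "n dvd d"
      using y by (simp add: is_primitive_root_power_eq_1_iff)
    then obtain e where e: "d = n * e" by blast
    then have "e dvd q"
      using d(1) n by (simp add: mult.commute)
    moreover have "e \<noteq> 1"
    proof
      assume "e = 1"
      then have "z ^ n = 1"
        using d(2) e by (simp add: is_primitive_root_def)
      then have "y ^ n' = 1"
        by (simp add: n' power_mult z)
      then show False
        using y n n' by (auto simp: is_primitive_root_power_eq_1_iff dest: dvd_imp_le)
    qed
    ultimately have "e = q"
      using \<open>prime q\<close> by (metis prime_nat_iff)
    then show ?thesis
      using d(2) e by (auto simp: mult.commute)
  qed
qed

text \<open>The powers of \<open>z\<close> with exponent below \<open>n\<close> are distinct, hence
  exhaust the roots of X^n - 1, of which there are at most \<open>n\<close>.\<close>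

lemma root_of_unity_is_power:
  assumes "is_primitive_root n (z :: 'a::field)" "y ^ n = 1"
  shows "\<exists>k. y = z ^ k"
proof -
  let ?R = "{x. poly (monom 1 n - 1) x = (0 :: 'a)}"
  have n: "n > 0" and z0: "z \<noteq> 0"
    using assms(1) by (auto simp: is_primitive_root_def power_0_left)
  have "coeff (monom 1 n - 1 :: 'a poly) n = 1"
    using n by simp
  then have nz: "monom 1 n - 1 \<noteq> (0 :: 'a poly)"
    by (metis coeff_0 zero_neq_one)
  have "inj_on (\<lambda>k. z ^ k) {..<n}"
  proof (rule linorder_inj_onI')
    fix i j assume ij: "i \<in> {..<n}" "j \<in> {..<n}" "i < j"
    then have "z ^ j = z ^ i * z ^ (j - i)"
      by (simp flip: power_add)
    moreover have "z ^ (j - i) \<noteq> 1"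
      using assms(1) ij by (auto simp: is_primitive_root_def)
    ultimately show "z ^ i \<noteq> z ^ j"
      using z0 by simp
  qed
  then have "card ((\<lambda>k. z ^ k) ` {..<n}) = n"
    by (simp add: card_image)
  moreover have "card ?R \<le> n"
    using card_poly_roots_bound[OF nz] degree_diff_le[of "monom (1::'a) n" n 1]
    by (simp add: degree_monom_eq)
  moreover have "(\<lambda>k. z ^ k) ` {..<n} \<subseteq> ?R"
    using assms(1)
    by (auto simp: poly_monom is_primitive_root_power_eq_1_iff simp flip: power_mult)
  ultimately have "(\<lambda>k. z ^ k) ` {..<n} = ?R"
    using poly_roots_finite[OF nz] by (intro card_seteq) auto
  moreover have "y \<in> ?R"
    using assms(2) by (simp add: poly_monom)
  ultimately show ?thesis by blast
qed

text \<open>Since x^p - 1 = (x - 1)^p in characteristic \<open>p\<close>, the only p-th root of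
  unity is 1, and the p-part of an exponent can be stripped. This is the source of
  \<open>coprime_part p l\<close> in the final statement.\<close>

lemma power_CHAR_power_eq_1_iff:
  fixes z :: "'a::field"
  assumes "CHAR('a) = p" "p > 0"
  shows "z ^ (p ^ k * n) = 1 \<longleftrightarrow> z ^ n = 1"
proof (induction k)
  case (Suc k)
  have p: "prime p"
    using prime_CHAR_semidom[where 'a = 'a] assms by simp
  have "x ^ p = 1 \<longleftrightarrow> x = 1" for x :: 'a
  proof
    assume "x ^ p = 1"
    moreover have "(x - 1 + 1) ^ p = (x - 1) ^ p + 1 ^ p"
      by (rule freshmans_dream) (use p assms(1) in auto)
    ultimately have "(x - 1) ^ p = 0"
      by simp
    then show "x = 1" by simp
  qed simp
  from this[of "z ^ (p ^ k * n)"] Suc show ?case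
    by (simp flip: power_mult add: mult_ac)
qed simp

section \<open>Dilations and automorphisms\<close>

lemma mem_xpow_ideal_iff: "p \<in> xpow_ideal m \<longleftrightarrow> (\<forall>k<m. coeff p k = 0)"
  unfolding xpow_ideal_def monom_1_dvd_iff'[symmetric] by (auto simp: dvd_def)

lemma coeff_dilation [simp]: "coeff (dilation \<mu> p) k = \<mu> ^ k * coeff p k"
  by (simp add: dilation_def coeff_pcompose_linear)

lemma dilation_dilation: "dilation \<mu> (dilation \<nu> p) = dilation (\<mu> * \<nu>) p"
  by (simp add: poly_eq_iff power_mult_distrib mult_ac)

lemma dilation_1 [simp]: "dilation 1 p = p"
  by (simp add: poly_eq_iff)

text \<open>Closure under the inverse dilation supplies the two-sided inverse on \<open>A\<close>,
  hence bijectivity; compatibility with the operations is that of composition of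
  polynomials.\<close>

lemma dilation_in_alg_auto:
  fixes A :: "'a::field poly set"
  assumes A: "poly_subalgebra A" and "\<mu> \<noteq> 0"
    and maps: "\<And>p. p \<in> A \<Longrightarrow> dilation \<mu> p \<in> A" "\<And>p. p \<in> A \<Longrightarrow> dilation (inverse \<mu>) p \<in> A"
  shows "restrict (dilation \<mu>) A \<in> alg_auto A"
proof -
  have closed: "p + q \<in> A" "p * q \<in> A" "smult c p \<in> A" "1 \<in> A"
    if "p \<in> A" "q \<in> A" for p q c
    using A that unfolding poly_subalgebra_def
    by (auto intro: poly_space.subspace_add poly_space.subspace_scale)
  have one: "1 \<in> A"
    using A by (simp add: poly_subalgebra_def)
  have "bij_betw (dilation \<mu>) A A"
    by (rule bij_betw_byWitness[of _ "dilation (inverse \<mu>)"])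
      (use maps \<open>\<mu> \<noteq> 0\<close> in \<open>auto simp: dilation_dilation\<close>)
  then have "restrict (dilation \<mu>) A \<in> Bij A"
    by (simp add: Bij_def)
  then show ?thesis
    using closed one
    by (auto simp: alg_auto_def dilation_def pcompose_add pcompose_mult pcompose_smult pcompose_1)
qed

section \<open>Extension of automorphisms to K[x]\<close>

lemma power_dvd_power_imp_dvd:
  fixes u v :: "'a::alg_closed_field poly"
  assumes "u ^ n dvd v ^ n" "n > 0" "u \<noteq> 0"
  shows "u dvd v"
  using assms
proof (induction "degree u" arbitrary: u v)
  case 0
  then have "is_unit u"
    by (simp add: is_unit_iff_degree)
  then show ?case
    by (rule unit_imp_dvd)
next
  case (Suc d)
  obtain a where "poly u a = 0"
    using alg_closed_imp_poly_has_root[of u] Suc.hyps by auto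
  then obtain u' where u': "u = [:-a, 1:] * u'"
    by (auto simp: poly_eq_0_iff_dvd)
  obtain r where "v ^ n = u ^ n * r"
    using Suc.prems by blast
  \<comment> \<open>Evaluation at a root \<open>a\<close> of \<open>u\<close> shows that
    \<open>v\<close> vanishes there too. The factor x - a then cancels from both n-th powers and the
    degree of \<open>u\<close> drops by one.\<close>
  then have "poly v a ^ n = poly u a ^ n * poly r a"
    by (simp flip: poly_power poly_mult)
  then have "poly v a = 0"
    using Suc.prems \<open>poly u a = 0\<close> by (simp add: power_0_left)
  then obtain v' where v': "v = [:-a, 1:] * v'"
    by (auto simp: poly_eq_0_iff_dvd)
  have "u' ^ n dvd v' ^ n"
    using Suc.prems(1) unfolding u' v' power_mult_distrib by (subst (asm) dvd_mult_cancel_left) auto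
  moreover have "d = degree u'"
    using Suc.hyps(2) Suc.prems(3) degree_mult_eq[of "[:-a, 1:]" u'] unfolding u'
    by (cases "u' = 0") auto
  ultimately have "u' dvd v'"
    using Suc.hyps(1) Suc.prems(2,3) u' by (metis mult_zero_right)
  then show ?case
    unfolding u' v' by (rule mult_dvd_mono[OF dvd_refl])
qed

text \<open>Every automorphism extends to \<open>K[x]\<close>: the images \<open>u\<close>, \<open>v\<close> of \<open>x\<^sup>m\<close>, \<open>x\<^sup>m\<^sup>+\<^sup>1\<close> satisfy
  \<open>v\<^sup>m = u\<^sup>m\<^sup>+\<^sup>1\<close>, so \<open>w = v / u\<close> is a polynomial, which is the image of \<open>x\<close>.\<close>

lemma alg_auto_eq_pcompose:
  fixes A :: "'a::alg_closed_field poly set"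
  assumes A: "poly_subalgebra A" "xpow_ideal m \<subseteq> A" and "m > 0" and \<phi>: "\<phi> \<in> alg_auto A"
  obtains w where "w \<noteq> 0" "\<And>q. \<phi> (monom 1 m * q) = w ^ m * pcompose q w"
    "\<And>p. p \<in> A \<Longrightarrow> \<phi> p = pcompose p w"
proof -
  have mult: "p * q \<in> A" if "p \<in> A" "q \<in> A" for p q
    using A that by (auto simp: poly_subalgebra_def)
  have scale: "smult c p \<in> A" if "p \<in> A" for p c
    using A that by (auto simp: poly_subalgebra_def intro: poly_space.subspace_scale)
  have "0 \<in> A" and one: "1 \<in> A"
    using A unfolding poly_subalgebra_def by (auto intro: poly_space.subspace_0)
  have ideal: "monom 1 m * q \<in> A" for q
    using A(2) by (auto simp: xpow_ideal_def)
  have bij: "bij_betw \<phi> A A" and hom: "\<phi> 1 = 1"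
      "\<And>p q. p \<in> A \<Longrightarrow> q \<in> A \<Longrightarrow> \<phi> (p + q) = \<phi> p + \<phi> q"
      "\<And>p q. p \<in> A \<Longrightarrow> q \<in> A \<Longrightarrow> \<phi> (p * q) = \<phi> p * \<phi> q"
      "\<And>c p. p \<in> A \<Longrightarrow> \<phi> (smult c p) = smult c (\<phi> p)"
    using \<phi> by (auto simp: alg_auto_def Bij_def)
  have \<phi>0: "\<phi> 0 = 0"
    using hom(4)[of 0 0] \<open>0 \<in> A\<close> by simp
  have pow: "p ^ k \<in> A \<and> \<phi> (p ^ k) = \<phi> p ^ k" if "p \<in> A" for p k
    using that by (induction k) (simp_all add: one mult hom(1,3))
  have mon: "monom 1 (m + j) \<in> A" for j
    using ideal[of "monom 1 j"] by (simp add: mult_monom)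
  define u v where "u = \<phi> (monom 1 m)" and "v = \<phi> (monom 1 (Suc m))"
  have mA: "monom 1 m \<in> A" "monom 1 (Suc m) \<in> A"
    using mon[of 0] mon[of 1] by auto
  have "u \<noteq> 0"
  proof
    assume "u = 0"
    then have "monom 1 m = (0 :: 'a poly)"
      using inj_onD[OF bij_betw_imp_inj_on[OF bij], of "monom 1 m" 0] mA \<open>0 \<in> A\<close> \<phi>0
      by (simp add: u_def)
    then show False by simp
  qed
  \<comment> \<open>Both powers are images of the same monomial x^(m(m+1)).\<close>
  have "v ^ m = \<phi> (monom 1 (Suc m) ^ m)" "u ^ Suc m = \<phi> (monom 1 m ^ Suc m)"
    using pow mA by (auto simp: u_def v_def simp del: power_Suc)
  then have vu: "v ^ m = u ^ Suc m"
    by (simp add: monom_power mult.commute del: power_Suc)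
  then have "u ^ m dvd v ^ m" by simp
  then have "u dvd v"
    using power_dvd_power_imp_dvd \<open>m > 0\<close> \<open>u \<noteq> 0\<close> by blast
  then obtain w where w: "v = u * w" by blast
  with vu \<open>u \<noteq> 0\<close> have u: "u = w ^ m"
    by (simp add: power_mult_distrib)
  have "w \<noteq> 0"
    using u \<open>u \<noteq> 0\<close> \<open>m > 0\<close> by auto
  have \<phi>_mon: "\<phi> (monom 1 (m + j)) = w ^ (m + j)" for j
  proof -
    \<comment> \<open>As x^j need not lie in \<open>A\<close>, the image of x^(m+j) is found after
      multiplication by x^(mj): the product is also (x^(m+1))^j x^m, whose factors have the known
      images \<open>v\<close> and \<open>u\<close>.\<close>
    have eq: "monom 1 m ^ j * monom 1 (m + j) = monom (1::'a) (Suc m) ^ j * monom 1 m"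
      by (simp add: monom_power mult_monom algebra_simps)
    have "u ^ j * \<phi> (monom 1 (m + j)) = \<phi> (monom 1 m ^ j * monom 1 (m + j))"
      using pow mA mon by (simp add: hom u_def)
    also have "\<dots> = v ^ j * u"
      unfolding eq using pow mA by (simp add: hom u_def v_def)
    also have "\<dots> = u ^ j * w ^ (m + j)"
      by (simp add: w power_mult_distrib power_add u)
    finally show ?thesis
      using \<open>u \<noteq> 0\<close> by simp
  qed
  have \<phi>_ideal: "\<phi> (monom 1 m * q) = w ^ m * pcompose q w" for q
  proof -
    \<comment> \<open>The shift \<open>j\<close> is kept arbitrary because passing to the tail of
      \<open>pCons a q\<close> moves one factor x into the monomial.\<close>
    have "\<phi> (monom 1 m * (monom 1 j * q)) = w ^ (m + j) * pcompose q w" for j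
    proof (induction q arbitrary: j)
      case (pCons a q)
      have q: "monom 1 m * (monom 1 j * pCons a q) =
          smult a (monom 1 (m + j)) + monom 1 m * (monom 1 (Suc j) * q)"
        by (simp add: poly_eq_iff coeff_monom_mult coeff_pCons split: nat.splits)
          (auto intro!: arg_cong[where f = "coeff q"])
      have "\<phi> (monom 1 m * (monom 1 j * pCons a q)) =
          smult a (w ^ (m + j)) + w ^ (m + Suc j) * pcompose q w"
        unfolding q using mon ideal by (simp add: hom scale \<phi>_mon pCons.IH del: power_Suc)
      then show ?case
        by (simp add: pcompose_pCons algebra_simps)
    qed (simp add: \<phi>0)
    from this[of 0] show ?thesis by simp
  qed
  moreover have "\<phi> p = pcompose p w" if "p \<in> A" for p
  proof -
    \<comment> \<open>Multiplication by x^m moves \<open>p\<close> into the ideal, where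
      \<open>\<phi>\<close> is already known; the factor \<open>u\<close> cancels
      afterwards.\<close>
    have "u * \<phi> p = w ^ m * pcompose p w"
      using hom(3)[OF mA(1) that] \<phi>_ideal[of p] by (simp add: u_def)
    then show ?thesis
      using u \<open>u \<noteq> 0\<close> by (metis mult_left_cancel)
  qed
  ultimately show ?thesis
    using that \<open>w \<noteq> 0\<close> by blast
qed

text \<open>Surjectivity of \<open>\<phi>\<close> forces the image \<open>w\<close> of x to have
  degree 1, and the condition on x^(m-1) in \<open>\<A> m\<close> excludes a constant term of
  \<open>w\<close>.\<close>

lemma alg_auto_eq_dilation:
  fixes A :: "'a::alg_closed_field poly set"
  assumes A: "A \<in> \<A> m" and "m > 0" and \<phi>: "\<phi> \<in> alg_auto A"
  obtains \<mu> where "\<mu> \<noteq> 0" "\<phi> = restrict (dilation \<mu>) A"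
proof -
  have A': "poly_subalgebra A" "xpow_ideal m \<subseteq> A" "monom 1 (m - 1) \<notin> A"
    using A by (auto simp: \<A>_def)
  obtain w where w: "w \<noteq> 0" "\<And>q. \<phi> (monom 1 m * q) = w ^ m * pcompose q w"
    "\<And>p. p \<in> A \<Longrightarrow> \<phi> p = pcompose p w"
    using alg_auto_eq_pcompose[OF A'(1,2) \<open>m > 0\<close> \<phi>] by blast
  have bij: "bij_betw \<phi> A A" and ext: "\<phi> \<in> extensional A"
    using \<phi> by (auto simp: alg_auto_def Bij_def)
  have ideal: "monom 1 m * q \<in> A" for q
    using A'(2) by (auto simp: xpow_ideal_def)
  \<comment> \<open>Degrees multiply under composition, and both x^m and x^(m+1) are values of
    \<open>\<phi>\<close>; so the degree of \<open>w\<close> divides two consecutive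
    numbers.\<close>
  have "degree w dvd m + j" for j
  proof -
    have "monom 1 (m + j) \<in> \<phi> ` A"
      using ideal[of "monom 1 j"] bij by (simp add: mult_monom bij_betw_def)
    then obtain p where "monom 1 (m + j) = pcompose p w"
      using w(3) by auto
    then have "degree (pcompose p w) = m + j"
      by (metis degree_monom_eq zero_neq_one)
    then show ?thesis
      by (metis degree_pcompose dvd_triv_right)
  qed
  from this[of 0] this[of 1] have "degree w dvd 1"
    by (metis add_0_right dvd_add_right_iff)
  then have deg: "degree w = 1" by simp
  then obtain a b where ab: "w = [:b, a:]" "a \<noteq> 0"
    by (metis degree_pCons_eq_if degree_eq_zeroE pCons_cases degree_0 One_nat_def nat.inject zero_neq_one pCons_eq_0_iff)
  \<comment> \<open>Substituting the affine inverse (x - b)/a undoes composition with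
    \<open>w\<close>, so every multiple of \<open>w ^ m\<close> is the image of some element of x^m
    K[x].\<close>
  have "w ^ m * q \<in> A" for q
  proof -
    have "pcompose (pcompose q [:- b / a, 1 / a:]) w = q"
      using ab by (simp flip: pcompose_assoc add: pcompose_pCons)
    then have "w ^ m * q = \<phi> (monom 1 m * pcompose q [:- b / a, 1 / a:])"
      by (simp add: w(2))
    then show ?thesis
      using bij ideal by (auto simp: bij_betw_def)
  qed
  \<comment> \<open>If \<open>b \<noteq> 0\<close> then \<open>w\<^sup>m x\<^sup>m\<^sup>-\<^sup>1 \<equiv> b\<^sup>m x\<^sup>m\<^sup>-\<^sup>1\<close> modulo \<open>x\<^sup>m\<close> would put \<open>x\<^sup>m\<^sup>-\<^sup>1\<close> into \<open>A\<close>.\<close>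
  then have wA: "w ^ m * monom 1 (m - 1) \<in> A" .
  have "b = 0"
  proof (rule ccontr)
    assume "b \<noteq> 0"
    let ?r = "w ^ m * monom 1 (m - 1) - smult (b ^ m) (monom 1 (m - 1))"
    have b: "coeff (w ^ m) 0 = b ^ m"
      by (simp add: ab coeff_0_power)
    have "coeff ?r k = 0" if "k < m" for k
      using that b by (subst mult.commute) (cases "k = m - 1", auto simp: coeff_monom_mult)
    then have "?r \<in> xpow_ideal m"
      by (simp add: mem_xpow_ideal_iff)
    then have "smult (1 / b ^ m) (w ^ m * monom 1 (m - 1) - ?r) \<in> A"
      using A'(1,2) wA unfolding poly_subalgebra_def
      by (blast intro: poly_space.subspace_scale poly_space.subspace_diff)
    then show False
      using A'(3) \<open>b \<noteq> 0\<close> by simp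
  qed
  then have "\<phi> = restrict (dilation a) A"
    using w(3) ext ab by (auto simp: dilation_def extensional_def)
  then show ?thesis
    using that ab by blast
qed

text \<open>Indexing the automorphisms by natural exponents makes each of them a product of copies
  of the generator, so induction on the exponent suffices.\<close>

lemma carrier_AlgAutoGroup_eq_generate:
  fixes A :: "'a::field poly set"
  assumes A: "poly_subalgebra A"
    and autos: "alg_auto A = (\<lambda>k. restrict (dilation (\<mu> ^ k)) A) ` UNIV"
  shows "carrier (AlgAutoGroup A) = generate (AlgAutoGroup A) {restrict (dilation \<mu>) A}"
proof
  interpret group "AlgAutoGroup A"
    by (rule group_AlgAutoGroup[OF A])
  have auto: "restrict (dilation (\<mu> ^ k)) A \<in> alg_auto A" for k
    by (auto simp: autos)
  then have Bij: "restrict (dilation (\<mu> ^ k)) A \<in> Bij A" for k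
    by (auto simp: alg_auto_def)
  have maps: "dilation (\<mu> ^ k) p \<in> A" if "p \<in> A" for k p
    using Bij_imp_funcset[OF Bij[of k]] that by (auto simp: Pi_iff)
  have carrier: "carrier (AlgAutoGroup A) = alg_auto A"
    by (simp add: AlgAutoGroup_def)
  show "generate (AlgAutoGroup A) {restrict (dilation \<mu>) A} \<subseteq> carrier (AlgAutoGroup A)"
    using generate_incl[of "{restrict (dilation \<mu>) A}"] auto[of 1] by (simp add: carrier)
  have "restrict (dilation (\<mu> ^ k)) A \<in> generate (AlgAutoGroup A) {restrict (dilation \<mu>) A}" for k
  proof (induction k)
    case 0
    have "\<one>\<^bsub>AlgAutoGroup A\<^esub> = restrict (dilation (\<mu> ^ 0)) A"
      by (auto simp: AlgAutoGroup_def BijGroup_def)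
    then show ?case
      by (metis generate.one)
  next
    case (Suc k)
    have "restrict (dilation \<mu>) A \<otimes>\<^bsub>AlgAutoGroup A\<^esub> restrict (dilation (\<mu> ^ k)) A =
        restrict (dilation (\<mu> ^ Suc k)) A"
      using Bij[of 1] Bij[of k] maps[of _ k]
      by (auto simp: AlgAutoGroup_def BijGroup_def compose_def dilation_dilation restrict_def)
    moreover have "restrict (dilation \<mu>) A \<in>
        generate (AlgAutoGroup A) {restrict (dilation \<mu>) A}"
      by (simp add: generate.incl)
    ultimately show ?case
      using generate.eng Suc by metis
  qed
  then show "carrier (AlgAutoGroup A) \<subseteq> generate (AlgAutoGroup A) {restrict (dilation \<mu>) A}"
    by (auto simp: carrier autos)
qed

section \<open>Direct sums and canonical bases\<close>

text \<open>Long direct sums are assembled one summand at a time. The heads of two lists with equal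
  sums differ by an element of \<open>V \<inter> W\<close>, so the heads agree and then the tails
  do.\<close>

lemma is_direct_sum_Cons:
  assumes Vs: "is_direct_sum W Vs" and V: "poly_space.subspace V" and W: "poly_space.subspace W"
    and inter: "V \<inter> W \<subseteq> {0}"
  shows "is_direct_sum (V + W) (V # Vs)"
proof -
  have bij: "bij_betw sum_list (listset Vs) W"
    using Vs by (simp add: is_direct_sum_def)
  have "bij_betw sum_list (set_Cons V (listset Vs)) (V + W)"
  proof (rule bij_betw_imageI)
    show "inj_on sum_list (set_Cons V (listset Vs))"
    proof (rule inj_onI)
      fix xs ys assume "xs \<in> set_Cons V (listset Vs)" "ys \<in> set_Cons V (listset Vs)"
        and eq: "sum_list xs = sum_list ys"
      then obtain x xs' y ys' where xy: "xs = x # xs'" "ys = y # ys'" "x \<in> V" "y \<in> V"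
          "xs' \<in> listset Vs" "ys' \<in> listset Vs"
        by (auto simp: set_Cons_def)
      then have "sum_list xs' \<in> W" "sum_list ys' \<in> W"
        using bij by (auto simp: bij_betw_def)
      moreover have "x - y = sum_list ys' - sum_list xs'"
        using eq xy by (simp add: algebra_simps)
      ultimately have "x - y \<in> V \<inter> W"
        using poly_space.subspace_diff V W xy by (metis IntI)
      then have "x = y"
        using inter by auto
      then have "sum_list xs' = sum_list ys'"
        using eq xy by simp
      with xy \<open>x = y\<close> bij show "xs = ys"
        by (auto simp: bij_betw_def inj_on_def)
    qed
    have "W = sum_list ` listset Vs"
      using bij by (simp add: bij_betw_def)
    then show "sum_list ` set_Cons V (listset Vs) = V + W"
      by (force simp: set_Cons_def set_plus_def image_iff)
  qed
  then show ?thesis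
    using Vs V by (simp add: is_direct_sum_def)
qed

lemma subspace_line: "poly_space.subspace (line v)"
  unfolding line_def poly_space.subspace_def
  by (auto simp flip: smult_add_left intro: range_eqI[of _ _ 0])

lemma const_polys_eq_line: "const_polys = line 1"
  by (simp add: const_polys_def line_def)

lemma subspace_coeff_support:
  "poly_space.subspace {p :: 'a::field poly. \<forall>j<m. coeff p j \<noteq> 0 \<longrightarrow> j \<in> S}"
  unfolding poly_space.subspace_def by auto

text \<open>With no degrees left the space is x^m K[x] itself; each induction step splits off the
  term of degree \<open>i\<close>.\<close>

lemma is_direct_sum_monoms:
  assumes "distinct js" "set js \<subseteq> {..<m}"
  shows "is_direct_sum {p :: 'a::field poly. \<forall>j<m. coeff p j \<noteq> 0 \<longrightarrow> j \<in> set js}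
    (map (\<lambda>j. line (monom 1 j)) js @ [xpow_ideal m])"
  using assms
proof (induction js)
  case Nil
  have "{p :: 'a poly. \<forall>j<m. coeff p j = 0} = xpow_ideal m"
    by (auto simp: mem_xpow_ideal_iff)
  moreover have "poly_space.subspace {p :: 'a poly. \<forall>j<m. coeff p j = 0}"
    by (simp add: poly_space.subspace_def)
  moreover have "set_Cons V {[]} = (\<lambda>v. [v]) ` V" for V :: "'a poly set"
    by (auto simp: set_Cons_def)
  ultimately show ?case
    by (auto simp: is_direct_sum_def bij_betw_def inj_on_def image_iff)
next
  case (Cons i js)
  let ?W = "\<lambda>js. {p :: 'a poly. \<forall>j<m. coeff p j \<noteq> 0 \<longrightarrow> j \<in> set js}"
  have "poly_space.subspace (?W js)"
    by (rule subspace_coeff_support)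
  moreover have "line (monom 1 i) \<inter> ?W js \<subseteq> {0}"
    using Cons.prems by (auto simp: line_def smult_monom)
  ultimately have "is_direct_sum (line (monom 1 i) + ?W js)
      (line (monom 1 i) # map (\<lambda>j. line (monom 1 j)) js @ [xpow_ideal m])"
    using Cons by (intro is_direct_sum_Cons subspace_line) auto
  moreover have "line (monom 1 i) + ?W js = ?W (i # js)"
  proof
    show "line (monom 1 i) + ?W js \<subseteq> ?W (i # js)"
      by (auto simp: line_def set_plus_def split: if_splits)
    have "p \<in> line (monom 1 i) + ?W js" if "p \<in> ?W (i # js)" for p
    proof -
      have "smult (coeff p i) (monom 1 i) + (p - smult (coeff p i) (monom 1 i)) \<in>
          line (monom 1 i) + ?W js"
        using that by (intro set_plus_intro) (auto simp: line_def)
      then show ?thesis by simp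
    qed
    then show "?W (i # js) \<subseteq> line (monom 1 i) + ?W js" by blast
  qed
  ultimately show ?case by simp
qed

text \<open>The coefficient functionals in the degrees of \<open>I\<close> are dual to the family
  \<open>f\<close>. Applied to a vanishing combination they give independence, and
  \<open>expand\<close> gives spanning, so basis questions become comparisons of
  coefficients.\<close>

lemma is_basis_of_dual:
  fixes f :: "nat \<Rightarrow> 'a::field poly"
  assumes "finite I" "poly_space.subspace V" "\<And>i. i \<in> I \<Longrightarrow> f i \<in> V"
    and dual: "\<And>i j. i \<in> I \<Longrightarrow> j \<in> I \<Longrightarrow> coeff (f i) j = (if i = j then 1 else 0)"
    and expand: "\<And>p. p \<in> V \<Longrightarrow> p = (\<Sum>i\<in>I. smult (coeff p i) (f i))"
  shows "is_basis_of (f ` I) V"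
  unfolding is_basis_of_def
proof
  have inj: "inj_on f I"
    using dual by (metis inj_onI zero_neq_one)
  show "poly_space.independent (f ` I)"
  proof
    assume "poly_space.dependent (f ` I)"
    then obtain u i where u: "(\<Sum>v\<in>f ` I. smult (u v) v) = 0" "i \<in> I" "u (f i) \<noteq> 0"
      using poly_space.dependent_finite[of "f ` I"] \<open>finite I\<close> by auto
    have "coeff (\<Sum>j\<in>I. smult (u (f j)) (f j)) i = (\<Sum>j\<in>I. if j = i then u (f j) else 0)"
      unfolding coeff_sum by (intro sum.cong) (auto simp: dual \<open>i \<in> I\<close>)
    then show False
      using u \<open>finite I\<close> by (simp add: sum.reindex[OF inj])
  qed
  show "poly_space.span (f ` I) = V"
  proof
    show "poly_space.span (f ` I) \<subseteq> V"
      using assms by (intro poly_space.span_minimal) auto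
    show "V \<subseteq> poly_space.span (f ` I)"
    proof
      fix p assume "p \<in> V"
      have "(\<Sum>i\<in>I. smult (coeff p i) (f i)) \<in> poly_space.span (f ` I)"
        by (intro poly_space.span_sum poly_space.span_scale poly_space.span_base) auto
      then show "p \<in> poly_space.span (f ` I)"
        using expand[OF \<open>p \<in> V\<close>] by simp
    qed
  qed
qed

lemma coeff_trunc: "coeff (trunc m p) k = (if k < m then coeff p k else 0)" for p :: "'a::field poly"
proof -
  have "coeff p k = coeff (monom 1 m * (p div monom 1 m)) k + coeff (trunc m p) k"
    by (simp flip: coeff_add add: trunc_def)
  moreover have "coeff (trunc m p) k = 0" if "m \<le> k"
  proof (cases "trunc m p = 0")
    case False
    then have "degree (trunc m p) < m"
      using degree_mod_less[of "monom 1 m" p] by (simp add: trunc_def degree_monom_eq)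
    then show ?thesis
      using that by (simp add: coeff_eq_0)
  qed simp
  ultimately show ?thesis
    by (simp add: coeff_monom_mult)
qed

section \<open>The algebras \<open>Al m l\<close>\<close>

text \<open>Meant for \<open>n = m - 1 - l\<close>. Being cut out by linear conditions on
  coefficients, it replaces the generators of \<open>Al m l\<close> once
  \<open>Al_eq_coeff_alg\<close> identifies the two.\<close>

definition coeff_alg :: "nat \<Rightarrow> nat \<Rightarrow> 'a::field poly set" where
  "coeff_alg n m = {p. coeff p (m - 1) = coeff p n \<and> (\<forall>j<m - 1. \<not> n dvd j \<longrightarrow> coeff p j = 0)}"

lemma subspace_coeff_alg: "poly_space.subspace (coeff_alg n m)"
  by (auto simp: poly_space.subspace_def coeff_alg_def)

lemma gl_eq: "l \<le> m - 1 \<Longrightarrow> gl m l = monom 1 (m - 1 - l) + monom 1 (m - 1)"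
  by (auto simp: gl_def distrib_left mult_monom intro!: arg_cong[where f = "monom 1"])

text \<open>With n = m-1-l, expanding x^(in) (1 + x^l)^i gives x^(in) followed by terms of degree at
  least in + l. For i >= 2 this is at least 2n + l = n + (m-1), hence beyond m-1.\<close>

lemma coeff_gl_power:
  assumes "l < m - 1" "2 \<le> i" "k < m"
  shows "coeff (gl m l ^ i :: 'a::field poly) k = (if k = i * (m - 1 - l) then 1 else 0)"
proof -
  define n where "n = m - 1 - l"
  have "(1 + monom 1 l) - 1 dvd (1 + monom 1 l) ^ i - (1 :: 'a poly)"
    using power_diff_1_eq[of "1 + monom (1::'a) l" i] by (metis dvd_triv_left)
  then obtain r where r: "(1 + monom 1 l) ^ i - 1 = monom (1::'a) l * r"
    by auto
  have "gl m l ^ i = monom (1::'a) (i * n) * (1 + ((1 + monom 1 l) ^ i - 1))"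
    by (simp add: gl_def n_def power_mult_distrib monom_power mult.commute)
  also have "\<dots> = monom 1 (i * n) + monom 1 (i * n + l) * r"
    unfolding r by (simp add: distrib_left mult_monom flip: mult.assoc)
  finally have g: "gl m l ^ i = monom 1 (i * n) + monom (1::'a) (i * n + l) * r" .
  have "2 * n \<le> i * n"
    using assms(2) by simp
  then have "k < i * n + l"
    using assms(1,3) unfolding n_def by linarith
  then show ?thesis
    unfolding g by (simp add: coeff_monom_mult n_def)
qed

lemma trunc_gl_power:
  assumes "l < m - 1" "2 \<le> i" "i * (m - 1 - l) < m"
  shows "trunc m (gl m l ^ i :: 'a::field poly) = monom 1 (i * (m - 1 - l))"
  using assms by (auto simp: poly_eq_iff coeff_trunc coeff_gl_power)

text \<open>On these polynomials the coefficients in degrees \<open>n\<close> and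
  \<open>m - 1\<close> both obey the product rule of a derivation at 0, so their equality passes to
  products. The vanishing conditions do too, since a non-multiple of \<open>n\<close> is not a sum
  of two multiples.\<close>

lemma poly_subalgebra_coeff_alg:
  assumes "0 < n" "n < m - 1" "\<not> n dvd m - 1"
  shows "poly_subalgebra (coeff_alg n m :: 'a::field poly set)"
  unfolding poly_subalgebra_def
proof (intro conjI ballI)
  show "(1 :: 'a poly) \<in> coeff_alg n m"
    using assms by (auto simp: coeff_alg_def intro!: Nat.gr0I)
next
  fix p q :: "'a poly" assume "p \<in> coeff_alg n m" "q \<in> coeff_alg n m"
  then have p: "coeff p (m - 1) = coeff p n" "\<And>j. j < m - 1 \<Longrightarrow> \<not> n dvd j \<Longrightarrow> coeff p j = 0"
    and q: "coeff q (m - 1) = coeff q n" "\<And>j. j < m - 1 \<Longrightarrow> \<not> n dvd j \<Longrightarrow> coeff q j = 0"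
    by (auto simp: coeff_alg_def)
  \<comment> \<open>In degrees \<open>n\<close> and \<open>m - 1\<close> only the two extreme terms of the convolution survive.\<close>
  have ends: "coeff (p * q) k = coeff p 0 * coeff q k + coeff p k * coeff q 0"
    if "0 < k" "\<And>i. 0 < i \<Longrightarrow> i < k \<Longrightarrow> coeff p i * coeff q (k - i) = 0" for k
  proof -
    have "coeff (p * q) k = (\<Sum>i\<in>{0, k}. coeff p i * coeff q (k - i))"
      unfolding coeff_mult using that by (intro sum.mono_neutral_right) auto
    then show ?thesis
      using that(1) by simp
  qed
  have "coeff (p * q) (m - 1) = coeff p 0 * coeff q (m - 1) + coeff p (m - 1) * coeff q 0"
  proof (rule ends)
    fix i assume i: "0 < i" "i < m - 1"
    have "\<not> (n dvd i \<and> n dvd m - 1 - i)"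
      using assms(3) i by (metis dvd_diffD less_imp_le)
    moreover have "m - 1 - i < m - 1"
      using i by simp
    ultimately show "coeff p i * coeff q (m - 1 - i) = 0"
      using p(2) q(2) i(2) by (metis mult_zero_left mult_zero_right)
  qed (use assms in auto)
  moreover have "coeff (p * q) n = coeff p 0 * coeff q n + coeff p n * coeff q 0"
  proof (rule ends)
    fix i assume i: "0 < i" "i < n"
    then have "coeff p i = 0"
      using assms(2) by (intro p(2)) (auto dest: dvd_imp_le)
    then show "coeff p i * coeff q (n - i) = 0" by simp
  qed (use assms in auto)
  moreover have "coeff (p * q) j = 0" if j: "j < m - 1" "\<not> n dvd j" for j
    unfolding coeff_mult
  proof (rule sum.neutral, rule ballI)
    fix i assume i: "i \<in> {..j}"
    have "\<not> (n dvd i \<and> n dvd j - i)"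
      using j i by (metis atMost_iff dvd_diffD)
    moreover have "i < m - 1" "j - i < m - 1"
      using i j by auto
    ultimately show "coeff p i * coeff q (j - i) = 0"
      using p(2) q(2) by (metis mult_zero_left mult_zero_right)
  qed
  ultimately show "p * q \<in> coeff_alg n m"
    using p(1) q(1) by (simp add: coeff_alg_def)
qed (rule subspace_coeff_alg)

lemma coeff_alg_in_\<A>:
  assumes "0 < n" "n < m - 1" "\<not> n dvd m - 1"
  shows "(coeff_alg n m :: 'a::field poly set) \<in> \<A> m"
  using poly_subalgebra_coeff_alg[OF assms] assms
  by (auto simp: \<A>_def mem_xpow_ideal_iff coeff_alg_def)

lemma Al_eq_coeff_alg:
  assumes "l > 0" "l < m - 1" and ndvd: "\<not> m - 1 - l dvd m - 1"
  shows "(Al m l :: 'a::field poly set) = coeff_alg (m - 1 - l) m"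
proof
  define n where "n = m - 1 - l"
  have n: "0 < n" "n < m - 1" "\<not> n dvd m - 1"
    using assms by (auto simp: n_def)
  have gl: "gl m l = monom 1 n + monom (1::'a) (m - 1)"
    using assms by (simp add: gl_eq n_def)
  have in_C: "gl m l ^ i \<in> (coeff_alg n m :: 'a poly set)" if "i \<ge> 1" for i
  proof (cases "i = 1")
    case True
    then show ?thesis
      using n by (auto simp: coeff_alg_def gl)
  next
    case False
    with that have "2 \<le> i" by simp
    then have c: "coeff (gl m l ^ i :: 'a poly) k = (if k = i * n then 1 else 0)" if "k < m" for k
      using coeff_gl_power[of l m i k] that assms by (simp add: n_def)
    \<comment> \<open>The one surviving term avoids both linked degrees, so the condition equating
      their coefficients reads 0 = 0.\<close>
    have "m - 1 \<noteq> i * n" "n \<noteq> i * n"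
      using n \<open>2 \<le> i\<close> by auto
    then show ?thesis
      using n by (auto simp: coeff_alg_def c)
  qed
  have add: "p + q \<in> coeff_alg n m" if "p \<in> coeff_alg n m" "q \<in> coeff_alg n m" for p q :: "'a poly"
    using that by (rule poly_space.subspace_add[OF subspace_coeff_alg])
  have "const_polys \<subseteq> (coeff_alg n m :: 'a poly set)"
    using n by (auto simp: const_polys_def coeff_alg_def coeff_pCons split: nat.splits)
  moreover have "poly_space.span {gl m l ^ i | i. i \<ge> 1} \<subseteq> (coeff_alg n m :: 'a poly set)"
    by (rule poly_space.span_minimal[OF _ subspace_coeff_alg]) (use in_C in auto)
  moreover have "xpow_ideal m \<subseteq> (coeff_alg n m :: 'a poly set)"
    using n by (auto simp: mem_xpow_ideal_iff coeff_alg_def)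
  ultimately show "(Al m l :: 'a poly set) \<subseteq> coeff_alg (m - 1 - l) m"
    unfolding Al_def n_def[symmetric] by (auto elim!: set_plus_elim intro!: add)
  show "coeff_alg (m - 1 - l) m \<subseteq> (Al m l :: 'a poly set)"
  proof
    fix p :: "'a poly" assume "p \<in> coeff_alg (m - 1 - l) m"
    then have p: "coeff p (m - 1) = coeff p n" "\<And>j. j < m - 1 \<Longrightarrow> \<not> n dvd j \<Longrightarrow> coeff p j = 0"
      by (auto simp: coeff_alg_def n_def)
    \<comment> \<open>Below degree \<open>m\<close> the i-th power starts with x^(in), so the
      coefficient of \<open>p\<close> in that degree is its weight. The range up to \<open>m\<close>
      reaches every positive multiple of \<open>n\<close> below \<open>m\<close>; further powers
      contribute nothing there.\<close>
    define s where "s = (\<Sum>i\<in>{1..<m}. smult (coeff p (i * n)) (gl m l ^ i))"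
    have "s \<in> poly_space.span {gl m l ^ i | i. i \<ge> 1}"
      unfolding s_def
      by (intro poly_space.span_sum poly_space.span_scale poly_space.span_base) auto
    moreover have "[:coeff p 0:] \<in> const_polys"
      by (auto simp: const_polys_def)
    moreover have "p - ([:coeff p 0:] + s) \<in> xpow_ideal m"
      unfolding mem_xpow_ideal_iff
    proof (intro allI impI)
      fix k assume k: "k < m"
      have "coeff s k = coeff p n * coeff (gl m l) k +
          (\<Sum>i\<in>{2..<m}. coeff p (i * n) * coeff (gl m l ^ i) k)"
      proof -
        have "{1..<m} = insert 1 {2..<m}"
          using n by auto
        then show ?thesis
          by (simp add: s_def coeff_sum)
      qed
      also have "(\<Sum>i\<in>{2..<m}. coeff p (i * n) * coeff (gl m l ^ i) k) =
          (\<Sum>i\<in>{2..<m}. if i * n = k then coeff p k else 0)"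
        by (intro sum.cong) (use assms k in \<open>auto simp: coeff_gl_power n_def\<close>)
      also have "\<dots> = (if n dvd k \<and> 2 * n \<le> k then coeff p k else 0)"
      proof (cases "n dvd k")
        case True
        then obtain e where e: "k = e * n"
          by (metis dvdE mult.commute)
        have "e < m"
          using k n(1) unfolding e by (metis le_less_trans mult_le_mono2 nat_mult_1_right Suc_leI One_nat_def)
        have "(\<Sum>i\<in>{2..<m}. if i * n = k then coeff p k else 0) =
            (\<Sum>i\<in>{2..<m}. if i = e then coeff p k else 0)"
          using n(1) by (simp add: e)
        then show ?thesis
          using \<open>e < m\<close> n(1) by (simp add: e)
      qed (auto intro!: sum.neutral)
      finally have s: "coeff s k = coeff p n * coeff (gl m l) k +
          (if n dvd k \<and> 2 * n \<le> k then coeff p k else 0)" .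
      have "k = 0 \<or> k = n \<or> 2 * n \<le> k" if "n dvd k"
        using that by (auto simp: dvd_def)
      moreover have "coeff p k = 0" if "\<not> n dvd k" "k \<noteq> m - 1"
        using p(2)[of k] that k by simp
      \<comment> \<open>Degree \<open>m - 1\<close> stands apart: it is no multiple of
        \<open>n\<close>, and its coefficient comes from the second term of \<open>gl m l\<close>,
        with the weight \<open>coeff p n\<close> that equals \<open>coeff p (m - 1)\<close>.\<close>
      ultimately consider "k = 0" | "k = n" | "k = m - 1" | "n dvd k" "2 * n \<le> k" "k \<noteq> m - 1"
        | "\<not> n dvd k" "coeff p k = 0" "k \<noteq> m - 1" "k \<noteq> n"
        by auto
      then show "coeff (p - ([:coeff p 0:] + s)) k = 0"
        unfolding coeff_diff coeff_add s using n p(1)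
        by cases (auto simp: gl coeff_pCons split: nat.splits)
    qed
    ultimately have "([:coeff p 0:] + s) + (p - ([:coeff p 0:] + s)) \<in> Al m l"
      unfolding Al_def by (intro set_plus_intro)
    then show "p \<in> Al m l" by simp
  qed
qed

text \<open>The quotient \<open>i\<close> of \<open>m - 1\<close> by \<open>m - 1 - l\<close> is at
  least 2 because \<open>l > 0\<close>, so \<open>gl m l ^ i\<close> is congruent to x^(m-1) modulo
  x^m. This keeps \<open>Al m l\<close> out of \<open>\<A> m\<close> in the divisible case.\<close>

lemma monom_in_Al_of_dvd:
  assumes "l > 0" "l < m - 1" and "m - 1 - l dvd m - 1"
  shows "monom 1 (m - 1) \<in> (Al m l :: 'a::field poly set)"
proof -
  obtain i where i: "m - 1 = (m - 1 - l) * i"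
    using assms(3) by (elim dvdE)
  then have "i \<noteq> 0" "i \<noteq> 1"
    using assms by (auto intro!: Nat.gr0I)
  then have "2 \<le> i" by simp
  have "0 \<in> (const_polys :: 'a poly set)"
    by (auto simp: const_polys_def)
  moreover have "gl m l ^ i \<in> poly_space.span {gl m l ^ i | i. i \<ge> 1}"
    using \<open>2 \<le> i\<close> by (intro poly_space.span_base) auto
  moreover have "monom (1::'a) (m - 1) - gl m l ^ i \<in> xpow_ideal m"
    using i assms \<open>2 \<le> i\<close> by (auto simp: mem_xpow_ideal_iff coeff_gl_power mult.commute)
  ultimately have "0 + gl m l ^ i + (monom (1::'a) (m - 1) - gl m l ^ i) \<in> Al m l"
    unfolding Al_def by (intro set_plus_intro)
  then show ?thesis by simp
qed

section \<open>The set Gamma, the quotient algebra and its canonical basis\<close>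

lemma Gam_coeff_alg:
  assumes "0 < n" "n < m - 1"
  shows "Gam m (coeff_alg n m :: 'a::field poly set) = {k. 0 < k \<and> k < m - 1 \<and> n dvd k}"
proof (intro equalityI subsetI)
  fix k assume "k \<in> Gam m (coeff_alg n m :: 'a poly set)"
  then obtain p :: "'a poly" where k: "1 \<le> k" "k \<le> m - 1" and p: "p \<in> coeff_alg n m"
      "coeff p k = 1" "\<forall>j<k. coeff p j = 0"
    by (auto simp: Gam_def)
  \<comment> \<open>A lowest term in degree \<open>m - 1\<close> would force the same nonzero
    coefficient in the smaller degree \<open>n\<close>.\<close>
  have "k \<noteq> m - 1"
    using p assms by (auto simp: coeff_alg_def)
  moreover from this have "n dvd k"
    using p k by (auto simp: coeff_alg_def) (metis le_neq_implies_less One_nat_def zero_neq_one)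
  ultimately show "k \<in> {k. 0 < k \<and> k < m - 1 \<and> n dvd k}"
    using k by auto
next
  fix k assume "k \<in> {k. 0 < k \<and> k < m - 1 \<and> n dvd k}"
  then have k: "0 < k" "k < m - 1" "n dvd k" "n \<le> k"
    by (auto dest: dvd_imp_le)
  \<comment> \<open>Only for \<open>k = n\<close> does the monomial need the companion
    x^(m-1).\<close>
  have "monom 1 k + (if k = n then monom 1 (m - 1) else 0) \<in> (coeff_alg n m :: 'a poly set)"
    using k assms by (auto simp: coeff_alg_def)
  then show "k \<in> Gam m (coeff_alg n m :: 'a poly set)"
    using k unfolding Gam_def
    by (auto intro!: bexI[of _ "monom 1 k + (if k = n then monom 1 (m - 1) else 0)"])
qed

lemma quot_alg_coeff_alg:
  assumes "0 < m" "n < m"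
  shows "quot_alg m (coeff_alg n m) = {p \<in> coeff_alg n m. \<forall>k\<ge>m. coeff p k = 0}"
proof (intro equalityI subsetI)
  fix p :: "'a poly" assume "p \<in> quot_alg m (coeff_alg n m)"
  then show "p \<in> {p \<in> coeff_alg n m. \<forall>k\<ge>m. coeff p k = 0}"
    using assms by (auto simp: quot_alg_def coeff_alg_def coeff_trunc)
next
  fix p :: "'a poly" assume p: "p \<in> {p \<in> coeff_alg n m. \<forall>k\<ge>m. coeff p k = 0}"
  then have "p = trunc m p"
    by (auto simp: poly_eq_iff coeff_trunc)
  with p show "p \<in> quot_alg m (coeff_alg n m)"
    by (auto simp: quot_alg_def)
qed

text \<open>The equivalence contains existence and uniqueness. Uniqueness holds because a correction
  term in a degree below \<open>m - 1\<close> outside Gamma is killed by membership in the algebra,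
  and the one in degree \<open>m - 1\<close> is tied to the coefficient in degree
  \<open>n\<close>.\<close>

lemma is_canonical_basis_coeff_alg:
  fixes B :: "'a::field poly set"
  assumes n: "0 < n" "n < m - 1" and ndvd: "\<not> n dvd m - 1"
  shows "is_canonical_basis m (coeff_alg n m) B \<longleftrightarrow>
    B = insert 1 (insert (monom 1 n + monom 1 (m - 1))
      (monom 1 ` {k. n < k \<and> k < m - 1 \<and> n dvd k}))"
proof -
  let ?C = "coeff_alg n m :: 'a poly set"
  define \<Gamma> where "\<Gamma> = Gam m ?C"
  have \<Gamma>: "\<Gamma> = {k. 0 < k \<and> k < m - 1 \<and> n dvd k}"
    using Gam_coeff_alg[OF n] by (simp add: \<Gamma>_def)
  define h :: "nat \<Rightarrow> 'a poly"
    where "h k = monom 1 k + (if k = n then monom 1 (m - 1) else 0)" for k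
  have "\<Gamma> = insert n {k. n < k \<and> k < m - 1 \<and> n dvd k}"
    using n unfolding \<Gamma> by (auto dest: dvd_imp_le)
  moreover have "h ` {k. n < k \<and> k < m - 1 \<and> n dvd k} =
      monom 1 ` {k. n < k \<and> k < m - 1 \<and> n dvd k}"
    by (intro image_cong) (auto simp: h_def)
  ultimately have B: "insert 1 (h ` \<Gamma>) = insert 1 (insert (monom 1 n + monom 1 (m - 1))
      (monom 1 ` {k. n < k \<and> k < m - 1 \<and> n dvd k}))"
    by (simp add: h_def)
  have quot: "quot_alg m ?C = {p \<in> ?C. \<forall>k\<ge>m. coeff p k = 0}"
    using n by (intro quot_alg_coeff_alg) auto
  define \<Delta> where "\<Delta> \<gamma> = {\<delta>. \<delta> \<notin> \<Gamma> \<and> \<gamma> < \<delta> \<and> \<delta> \<le> m - 1}" for \<gamma>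
  have fin: "finite (\<Delta> \<gamma>)" for \<gamma>
    by (rule finite_subset[of _ "{..m - 1}"]) (auto simp: \<Delta>_def)
  have canonical: "is_canonical_basis m ?C B \<longleftrightarrow> is_basis_of B (quot_alg m ?C) \<and>
      (\<exists>f a. B = insert 1 (f ` \<Gamma>) \<and>
        (\<forall>\<gamma>\<in>\<Gamma>. f \<gamma> = monom 1 \<gamma> + (\<Sum>\<delta>\<in>\<Delta> \<gamma>. smult (a \<gamma> \<delta>) (monom 1 \<delta>))))"
    by (simp add: is_canonical_basis_def \<Gamma>_def \<Delta>_def)
  have "B = insert 1 (h ` \<Gamma>)" if "is_canonical_basis m ?C B"
  proof -
    obtain f a where basis: "is_basis_of B (quot_alg m ?C)" and f: "B = insert 1 (f ` \<Gamma>)"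
      "\<And>\<gamma>. \<gamma> \<in> \<Gamma> \<Longrightarrow> f \<gamma> = monom 1 \<gamma> + (\<Sum>\<delta>\<in>\<Delta> \<gamma>. smult (a \<gamma> \<delta>) (monom 1 \<delta>))"
      using \<open>is_canonical_basis m ?C B\<close> canonical by blast
    have "f \<gamma> = h \<gamma>" if \<gamma>: "\<gamma> \<in> \<Gamma>" for \<gamma>
    proof -
      have coeff_f: "coeff (f \<gamma>) k = (if k = \<gamma> then 1 else 0) + (if k \<in> \<Delta> \<gamma> then a \<gamma> k else 0)" for k
      proof -
        have "coeff (\<Sum>\<delta>\<in>\<Delta> \<gamma>. smult (a \<gamma> \<delta>) (monom 1 \<delta>)) k =
            (\<Sum>\<delta>\<in>\<Delta> \<gamma>. if \<delta> = k then a \<gamma> k else 0)"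
          unfolding coeff_sum by (intro sum.cong) auto
        then show ?thesis
          using fin by (auto simp: f(2)[OF \<gamma>])
      qed
      have "f \<gamma> \<in> B"
        using f(1) \<gamma> by blast
      then have "f \<gamma> \<in> quot_alg m ?C"
        using basis poly_space.span_base by (auto simp: is_basis_of_def)
      then have C: "coeff (f \<gamma>) (m - 1) = coeff (f \<gamma>) n" "\<And>k. k \<ge> m \<Longrightarrow> coeff (f \<gamma>) k = 0"
          "\<And>j. j < m - 1 \<Longrightarrow> \<not> n dvd j \<Longrightarrow> coeff (f \<gamma>) j = 0"
        unfolding quot by (auto simp: coeff_alg_def)
      \<comment> \<open>Hence no correction term has degree \<open>n\<close>, which fixes the
        coefficient there and with it the one in degree \<open>m - 1\<close>.\<close>
      have "n \<in> \<Gamma>"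
        using n by (simp add: \<Gamma>)
      then have fn: "coeff (f \<gamma>) n = (if n = \<gamma> then 1 else 0)"
        by (simp add: coeff_f \<Delta>_def)
      have "coeff (f \<gamma>) k = coeff (h \<gamma>) k" for k
      proof (cases "k < m - 1")
        case True
        have "coeff (f \<gamma>) k = (if k = \<gamma> then 1 else 0)"
        proof (cases "n dvd k")
          case True
          then have "k \<notin> \<Delta> \<gamma>"
            using \<open>k < m - 1\<close> by (auto simp: \<Delta>_def \<Gamma>)
          then show ?thesis
            by (simp add: coeff_f)
        next
          case False
          then show ?thesis
            using C(3) \<gamma> \<open>k < m - 1\<close> by (auto simp: \<Gamma>)
        qed
        then show ?thesis
          using True by (auto simp: h_def)
      next
        case False
        then show ?thesis
          using C(1) C(2)[of k] fn n \<gamma> by (cases "k = m - 1") (auto simp: h_def \<Gamma>)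
      qed
      then show ?thesis
        by (rule poly_eqI)
    qed
    then show ?thesis
      using f(1) by simp
  qed
  moreover have "is_canonical_basis m ?C (insert 1 (h ` \<Gamma>))"
  proof -
    have "m - 1 \<notin> \<Gamma>"
      by (simp add: \<Gamma>)
    define a :: "nat \<Rightarrow> nat \<Rightarrow> 'a" where "a \<gamma> \<delta> = (if \<gamma> = n \<and> \<delta> = m - 1 then 1 else 0)" for \<gamma> \<delta>
    have "h \<gamma> = monom 1 \<gamma> + (\<Sum>\<delta>\<in>\<Delta> \<gamma>. smult (a \<gamma> \<delta>) (monom 1 \<delta>))" if "\<gamma> \<in> \<Gamma>" for \<gamma>
    proof -
      have "m - 1 \<in> \<Delta> \<gamma>"
        using that \<open>m - 1 \<notin> \<Gamma>\<close> by (auto simp: \<Delta>_def \<Gamma>)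
      moreover have "(\<Sum>\<delta>\<in>\<Delta> \<gamma>. smult (a \<gamma> \<delta>) (monom 1 \<delta>)) =
          (\<Sum>\<delta>\<in>\<Delta> \<gamma>. if \<delta> = m - 1 then (if \<gamma> = n then monom 1 (m - 1) else 0) else 0)"
        by (intro sum.cong) (auto simp: a_def)
      ultimately show ?thesis
        using fin by (simp add: h_def)
    qed
    moreover have "is_basis_of (insert 1 (h ` \<Gamma>)) (quot_alg m ?C)"
    proof -
      let ?I = "insert 0 \<Gamma>"
      \<comment> \<open>The index 0 is adjoined for the basis element 1, making the whole basis one
        family dual to the coefficients in the degrees of \<open>?I\<close>.\<close>
      define h' where "h' k = (if k = 0 then 1 else h k)" for k
      have coeff_h': "coeff (h' i) k = (if k = i then 1 else if i = n \<and> k = m - 1 then 1 else 0)"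
        for i k
        using n by (auto simp: h'_def h_def)
      have "finite \<Gamma>"
        by (simp add: \<Gamma>)
      have "is_basis_of (h' ` ?I) (quot_alg m ?C)"
      proof (rule is_basis_of_dual)
        show "finite ?I"
          using \<open>finite \<Gamma>\<close> by simp
        show "poly_space.subspace (quot_alg m ?C)"
          unfolding quot using subspace_coeff_alg[of n m]
          by (auto simp: poly_space.subspace_def)
        show "h' i \<in> quot_alg m ?C" if "i \<in> ?I" for i
          using that n unfolding quot by (auto simp: coeff_alg_def coeff_h' \<Gamma>)
        show "coeff (h' i) j = (if i = j then 1 else 0)" if "i \<in> ?I" "j \<in> ?I" for i j
          using that n by (auto simp: coeff_h' \<Gamma>)
        fix p assume "p \<in> quot_alg m ?C"
        then have p: "coeff p (m - 1) = coeff p n" "\<And>k. k \<ge> m \<Longrightarrow> coeff p k = 0"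
            "\<And>j. j < m - 1 \<Longrightarrow> \<not> n dvd j \<Longrightarrow> coeff p j = 0"
          unfolding quot by (auto simp: coeff_alg_def)
        have "coeff p k = coeff (\<Sum>i\<in>?I. smult (coeff p i) (h' i)) k" for k
        proof -
          \<comment> \<open>The second summand records that degree \<open>m - 1\<close>, absent from
            \<open>?I\<close>, is reached only through \<open>h' n\<close>.\<close>
          have "coeff (\<Sum>i\<in>?I. smult (coeff p i) (h' i)) k =
              (\<Sum>i\<in>?I. (if i = k then coeff p k else 0) +
                (if i = n then if k = m - 1 then coeff p n else 0 else 0))"
            unfolding coeff_sum using n \<open>m - 1 \<notin> \<Gamma>\<close>
            by (intro sum.cong) (auto simp: coeff_h')
          also have "\<dots> = (if k \<in> ?I then coeff p k else 0) + (if k = m - 1 then coeff p n else 0)"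
            using \<open>finite ?I\<close> n by (simp add: sum.distrib \<Gamma>)
          also have "\<dots> = coeff p k"
          proof -
            consider "k < m - 1" | "k = m - 1" | "k \<ge> m"
              by linarith
            then show ?thesis
              using p n by cases (auto simp: \<Gamma>)
          qed
          finally show ?thesis ..
        qed
        then show "p = (\<Sum>i\<in>?I. smult (coeff p i) (h' i))"
          by (rule poly_eqI)
      qed
      moreover have "h' ` ?I = insert 1 (h ` \<Gamma>)"
        by (auto simp: h'_def \<Gamma> image_iff)
      ultimately show ?thesis by simp
    qed
    ultimately show ?thesis
      unfolding is_canonical_basis_def \<Gamma>_def \<Delta>_def by blast
  qed
  ultimately show ?thesis
    unfolding B by blast
qed

text \<open>Built from the right: \<open>W\<close> collects the monomials above degree
  \<open>n\<close> and the ideal, adjoining the line of x^n + x^(m-1) gives the elements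
  \<open>V\<close> without constant term, and the constants complete the algebra.\<close>

lemma is_direct_sum_coeff_alg:
  assumes n: "0 < n" "n < m - 1" "\<not> n dvd m - 1"
    and js: "distinct js" "set js = {k. n < k \<and> k < m - 1 \<and> n dvd k}"
  shows "is_direct_sum (coeff_alg n m :: 'a::field poly set)
    ([const_polys, line (monom 1 n + monom 1 (m - 1))] @ map (\<lambda>j. line (monom 1 j)) js @
     [xpow_ideal m])"
proof -
  let ?g = "monom 1 n + monom 1 (m - 1) :: 'a poly"
  define W :: "'a poly set" where "W = {p. \<forall>j<m. coeff p j \<noteq> 0 \<longrightarrow> j \<in> set js}"
  define V :: "'a poly set" where "V = {p \<in> coeff_alg n m. coeff p 0 = 0}"
  have W: "is_direct_sum W (map (\<lambda>j. line (monom 1 j)) js @ [xpow_ideal m])"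
    unfolding W_def by (intro is_direct_sum_monoms js(1)) (auto simp: js(2) elim: less_le_trans)
  have subspaces: "poly_space.subspace W" "poly_space.subspace V"
    unfolding W_def V_def coeff_alg_def
    by (rule subspace_coeff_support) (auto simp: poly_space.subspace_def)
  have W0: "coeff p k = 0"
    if "p \<in> W" "k < m" "k \<le> n \<or> k = m - 1 \<or> \<not> n dvd k" for p k
    using that js(2) by (auto simp: W_def)
  have V_eq: "line ?g + W = V"
  proof
    show "line ?g + W \<subseteq> V"
    proof
      fix p assume "p \<in> line ?g + W"
      then obtain c w where p: "p = smult c ?g + w" "w \<in> W"
        by (auto simp: line_def set_plus_def)
      have "coeff w 0 = 0" "coeff w n = 0" "coeff w (m - 1) = 0"
        using n by (auto intro!: W0[OF p(2)])
      moreover have "coeff w j = 0" if "j < m - 1" "\<not> n dvd j" for j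
        using that by (auto intro!: W0[OF p(2)])
      ultimately show "p \<in> V"
        using n by (auto simp: p(1) V_def coeff_alg_def)
    qed
    show "V \<subseteq> line ?g + W"
    proof
      fix p assume "p \<in> V"
      then have p: "coeff p (m - 1) = coeff p n" "coeff p 0 = 0"
          "\<And>j. j < m - 1 \<Longrightarrow> \<not> n dvd j \<Longrightarrow> coeff p j = 0"
        by (auto simp: V_def coeff_alg_def)
      have "j \<in> set js" if j: "j < m" "coeff (p - smult (coeff p n) ?g) j \<noteq> 0" for j
      proof -
        have "j \<noteq> m - 1" "j \<noteq> n" "j \<noteq> 0"
          using j(2) n p(1,2) by (auto intro!: Nat.gr0I split: if_splits)
        moreover from this have "j < m - 1"
          using j(1) by simp
        moreover from calculation have "n dvd j"
          using j(2) p(3)[of j] by auto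
        moreover from calculation have "n < j"
          using dvd_imp_le[of n j] by simp
        ultimately show ?thesis
          by (simp add: js(2))
      qed
      then have "smult (coeff p n) ?g + (p - smult (coeff p n) ?g) \<in> line ?g + W"
        by (intro set_plus_intro) (auto simp: line_def W_def)
      then show "p \<in> line ?g + W" by simp
    qed
  qed
  have "line ?g \<inter> W \<subseteq> {0}"
    using n js by (auto simp: line_def W_def)
  then have "is_direct_sum V (line ?g # map (\<lambda>j. line (monom 1 j)) js @ [xpow_ideal m])"
    unfolding V_eq[symmetric] by (intro is_direct_sum_Cons W subspace_line subspaces(1))
  moreover have "const_polys \<inter> V \<subseteq> {0}"
    by (auto simp: const_polys_def V_def)
  moreover have "const_polys + V = coeff_alg n m"
  proof
    show "const_polys + V \<subseteq> coeff_alg n m"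
      using n by (auto simp: const_polys_def V_def set_plus_def coeff_alg_def coeff_pCons split: nat.splits)
    show "coeff_alg n m \<subseteq> const_polys + V"
    proof
      fix p :: "'a poly" assume "p \<in> coeff_alg n m"
      then have "[:coeff p 0:] + (p - [:coeff p 0:]) \<in> const_polys + V"
        using n by (intro set_plus_intro)
          (auto simp: const_polys_def V_def coeff_alg_def coeff_pCons split: nat.splits)
      then show "p \<in> const_polys + V" by simp
    qed
  qed
  moreover have "poly_space.subspace (const_polys :: 'a poly set)"
    by (simp add: const_polys_eq_line subspace_line)
  ultimately show ?thesis
    using is_direct_sum_Cons[of V _ const_polys] subspaces(2) by simp
qed

section \<open>The automorphism group\<close>

lemma alg_auto_coeff_alg:
  assumes n: "0 < n" "n < m - 1" "\<not> n dvd m - 1"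
  shows "alg_auto (coeff_alg n m :: 'a::alg_closed_field poly set) =
    (\<lambda>\<mu>. restrict (dilation \<mu>) (coeff_alg n m)) ` {\<mu>. \<mu> ^ (m - 1 - n) = 1}"
proof (intro equalityI subsetI)
  fix \<phi> :: "'a poly \<Rightarrow> 'a poly" assume \<phi>: "\<phi> \<in> alg_auto (coeff_alg n m)"
  have "m > 0"
    using n by simp
  then obtain \<mu> where \<mu>: "\<mu> \<noteq> 0" "\<phi> = restrict (dilation \<mu>) (coeff_alg n m)"
    using alg_auto_eq_dilation[OF coeff_alg_in_\<A>[OF n] _ \<phi>] by blast
  let ?g = "monom 1 n + monom 1 (m - 1) :: 'a poly"
  have g: "?g \<in> coeff_alg n m"
    using n by (auto simp: coeff_alg_def)
  have "\<phi> ?g \<in> coeff_alg n m"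
    using \<phi> g Bij_imp_funcset by (auto simp: alg_auto_def Pi_iff)
  \<comment> \<open>The single test element \<open>?g\<close> suffices: its image must again have
    equal coefficients in degrees \<open>n\<close> and \<open>m - 1\<close>.\<close>
  then have "\<mu> ^ (m - 1) = \<mu> ^ n"
    using n g by (auto simp: \<mu>(2) coeff_alg_def)
  moreover have "\<mu> ^ (m - 1) = \<mu> ^ n * \<mu> ^ (m - 1 - n)"
    using n by (simp flip: power_add)
  ultimately have "\<mu> ^ (m - 1 - n) = 1"
    using \<mu>(1) by simp
  with \<mu>(2) show "\<phi> \<in> (\<lambda>\<mu>. restrict (dilation \<mu>) (coeff_alg n m)) ` {\<mu>. \<mu> ^ (m - 1 - n) = 1}"
    by blast
next
  \<comment> \<open>Rescaling coefficients preserves vanishing, so only the equality of the two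
    linked coefficients needs the root of unity.\<close>
  have maps: "dilation \<mu> p \<in> coeff_alg n m"
    if "\<mu> ^ (m - 1 - n) = 1" "p \<in> coeff_alg n m" for \<mu> and p :: "'a poly"
  proof -
    have "\<mu> ^ (m - 1) = \<mu> ^ n * \<mu> ^ (m - 1 - n)"
      using n by (simp flip: power_add)
    then show ?thesis
      using that by (auto simp: coeff_alg_def)
  qed
  fix \<phi> :: "'a poly \<Rightarrow> 'a poly"
  assume "\<phi> \<in> (\<lambda>\<mu>. restrict (dilation \<mu>) (coeff_alg n m)) ` {\<mu>. \<mu> ^ (m - 1 - n) = 1}"
  then obtain \<mu> where \<mu>: "\<mu> ^ (m - 1 - n) = 1" "\<phi> = restrict (dilation \<mu>) (coeff_alg n m)"
    by auto
  have "\<mu> \<noteq> 0"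
    using \<mu>(1) n by (auto simp: power_0_left split: if_splits)
  moreover have "inverse \<mu> ^ (m - 1 - n) = 1"
    using \<mu>(1) by (simp add: power_inverse)
  ultimately show "\<phi> \<in> alg_auto (coeff_alg n m)"
    unfolding \<mu>(2) using \<mu>(1) maps n
    by (intro dilation_in_alg_auto poly_subalgebra_coeff_alg) auto
qed

text \<open>The order \<open>l\<close> is decoupled from the exponent \<open>m - 1 - n\<close>: only
  the roots of unity must coincide. This covers characteristic 0 and, with the p-free part of the
  exponent, characteristic p at once.\<close>

lemma Aut_generated_by_root_coeff_alg:
  assumes n: "0 < n" "n < m - 1" "\<not> n dvd m - 1"
    and l: "of_nat l \<noteq> (0 :: 'a::alg_closed_field)"
      "\<And>\<mu>::'a. \<mu> ^ (m - 1 - n) = 1 \<longleftrightarrow> \<mu> ^ l = 1"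
  shows "Aut_generated_by_root (coeff_alg n m :: 'a poly set) l"
  unfolding Aut_generated_by_root_def
proof (intro conjI allI impI)
  show "\<exists>\<mu>::'a. is_primitive_root l \<mu>"
    using l(1) by (rule ex_is_primitive_root)
next
  fix \<mu> :: 'a assume \<mu>: "is_primitive_root l \<mu>"
  then have "(\<mu> ^ k) ^ l = 1" for k
    by (simp add: is_primitive_root_power_eq_1_iff flip: power_mult)
  then have "{\<nu>. \<nu> ^ (m - 1 - n) = 1} = range (\<lambda>k. \<mu> ^ k)"
    unfolding l(2) using root_of_unity_is_power[OF \<mu>] by blast
  then have "alg_auto (coeff_alg n m) = range (\<lambda>k. restrict (dilation (\<mu> ^ k)) (coeff_alg n m))"
    by (simp add: alg_auto_coeff_alg[OF n] image_image)
  then show "carrier (AlgAutoGroup (coeff_alg n m)) =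
      generate (AlgAutoGroup (coeff_alg n m)) {restrict (dilation \<mu>) (coeff_alg n m)}"
    by (intro carrier_AlgAutoGroup_eq_generate poly_subalgebra_coeff_alg n)
qed

theorem lemma3p12:
  fixes m l :: nat and g :: "'a::alg_closed_field poly" and A :: "'a poly set"
  assumes "m \<ge> 4" and "1 \<le> l" and "l \<le> m - 3"
  assumes "g = gl m l" and "A = Al m l"
  shows "(A \<in> \<A> m \<and> A \<noteq> const_polys + xpow_ideal m \<longleftrightarrow> \<not> (m - 1 - l) dvd (m - 1)) \<and>
    (\<not> (m - 1 - l) dvd (m - 1) \<longrightarrow>
      is_direct_sum A
        ([const_polys, line g] @
         map (\<lambda>i. line (trunc m (g ^ i)))
             (sorted_list_of_set {i. 2 \<le> i \<and> real i < real (m - 1) / real (m - 1 - l)}) @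
         [xpow_ideal m]) \<and>
      Gam m A = {i * (m - 1 - l) | i. 1 \<le> i \<and> real i < real (m - 1) / real (m - 1 - l)} \<and>
      (\<forall>B. is_canonical_basis m A B \<longleftrightarrow>
         B = {1, g} \<union>
             {monom 1 (i * (m - 1 - l)) | i. 2 \<le> i \<and> real i < real (m - 1) / real (m - 1 - l)}) \<and>
      (CHAR('a) = 0 \<longrightarrow> Aut_generated_by_root A l) \<and>
      (\<forall>p. CHAR('a) = p \<and> p > 0 \<longrightarrow> Aut_generated_by_root A (coprime_part p l)))"
proof -
  define n where "n = m - 1 - l"
  have n: "0 < n" "n < m - 1" and l: "0 < l" "l < m - 1" "m - 1 - n = l"
    using assms(1-3) by (auto simp: n_def)
  have g: "g = monom 1 n + monom 1 (m - 1)"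
    using l assms(4) by (simp add: gl_eq n_def)
  have less: "real i < real (m - 1) / real n \<longleftrightarrow> i * n < m - 1" for i
    using n(1) by (simp add: field_simps flip: of_nat_mult)
  \<comment> \<open>Used with \<open>a = 1\<close> for Gamma and with \<open>a = 2\<close> for the
    summands and basis elements beyond g.\<close>
  have multiples: "(\<lambda>i. i * n) ` {i. a \<le> i \<and> i * n < m - 1} = {k. a * n \<le> k \<and> k < m - 1 \<and> n dvd k}" for a
    using n(1) by (auto simp: image_iff dvd_def mult.commute)
  have "A \<in> \<A> m \<and> A \<noteq> const_polys + xpow_ideal m" if ndvd: "\<not> n dvd m - 1"
  proof
    have A: "A = coeff_alg n m"
      using Al_eq_coeff_alg[OF l(1,2)] ndvd assms(5) by (simp add: n_def)
    show "A \<in> \<A> m"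
      using coeff_alg_in_\<A>[OF n ndvd] A by simp
    have "g \<in> A"
      using n by (auto simp: A g coeff_alg_def)
    \<comment> \<open>Degree \<open>n\<close> is positive and below \<open>m\<close>, so its
      coefficient separates g from K + x^m K[x].\<close>
    moreover have "coeff p n = 0" if "p \<in> const_polys + xpow_ideal m" for p :: "'a poly"
      using that n by (auto simp: set_plus_def const_polys_def mem_xpow_ideal_iff coeff_pCons split: nat.splits)
    moreover have "coeff g n = 1"
      using n by (simp add: g)
    ultimately show "A \<noteq> const_polys + xpow_ideal m"
      by (metis zero_neq_one)
  qed
  moreover have "A \<notin> \<A> m" if "n dvd m - 1"
    using monom_in_Al_of_dvd[OF l(1,2)] that assms(5) by (auto simp: \<A>_def n_def)
  moreover have "is_direct_sum A
        ([const_polys, line g] @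
         map (\<lambda>i. line (trunc m (g ^ i)))
             (sorted_list_of_set {i. 2 \<le> i \<and> i * n < m - 1}) @
         [xpow_ideal m]) \<and>
      Gam m A = {i * n | i. 1 \<le> i \<and> i * n < m - 1} \<and>
      (\<forall>B. is_canonical_basis m A B \<longleftrightarrow>
         B = {1, g} \<union> {monom 1 (i * n) | i. 2 \<le> i \<and> i * n < m - 1}) \<and>
      (CHAR('a) = 0 \<longrightarrow> Aut_generated_by_root A l) \<and>
      (\<forall>p. CHAR('a) = p \<and> p > 0 \<longrightarrow> Aut_generated_by_root A (coprime_part p l))"
    if ndvd: "\<not> n dvd m - 1"
  proof (intro conjI allI impI)
    have A: "A = coeff_alg n m"
      using Al_eq_coeff_alg[OF l(1,2)] ndvd assms(5) by (simp add: n_def)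
    have above_n: "2 * n \<le> k \<longleftrightarrow> n < k" if "n dvd k" for k
      using that n(1) by (auto simp: dvd_def)
    have monoms: "{k. n < k \<and> k < m - 1 \<and> n dvd k} = (\<lambda>i. i * n) ` {i. 2 \<le> i \<and> i * n < m - 1}"
      unfolding multiples using above_n by auto
    define ks where "ks = sorted_list_of_set {i. 2 \<le> i \<and> i * n < m - 1}"
    have "{i. 2 \<le> i \<and> i * n < m - 1} \<subseteq> {..<m}"
    proof
      fix i assume "i \<in> {i. 2 \<le> i \<and> i * n < m - 1}"
      then have "i * n < m"
        by auto
      then show "i \<in> {..<m}"
        using n(1) by (metis One_nat_def Suc_leI le_less_trans lessThan_iff mult.right_neutral mult_le_mono2)
    qed
    then have "finite {i. 2 \<le> i \<and> i * n < m - 1}"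
      by (rule finite_subset) simp
    then have ks: "set ks = {i. 2 \<le> i \<and> i * n < m - 1}" "distinct ks"
      by (auto simp: ks_def)
    have truncs: "map (\<lambda>i. line (trunc m (g ^ i))) ks = map (\<lambda>j. line (monom 1 j)) (map (\<lambda>i. i * n) ks)"
      using ks(1) l by (auto simp: assms(4) trunc_gl_power n_def)
    have "distinct (map (\<lambda>i. i * n) ks)"
      using ks(2) n(1) by (simp add: distinct_map inj_on_def)
    moreover have "set (map (\<lambda>i. i * n) ks) = {k. n < k \<and> k < m - 1 \<and> n dvd k}"
      using monoms by (simp add: ks(1))
    ultimately show "is_direct_sum A ([const_polys, line g] @
        map (\<lambda>i. line (trunc m (g ^ i))) (sorted_list_of_set {i. 2 \<le> i \<and> i * n < m - 1}) @
        [xpow_ideal m])"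
      using is_direct_sum_coeff_alg[OF n ndvd, of "map (\<lambda>i. i * n) ks"]
      unfolding ks_def[symmetric] truncs unfolding A g by simp
    have "{i * n | i. 1 \<le> i \<and> i * n < m - 1} = {k. 0 < k \<and> k < m - 1 \<and> n dvd k}"
      using multiples[of 1] n(1) by (auto simp: dvd_imp_le setcompr_eq_image)
    then show "Gam m A = {i * n | i. 1 \<le> i \<and> i * n < m - 1}"
      using Gam_coeff_alg[OF n] A by simp
    show "is_canonical_basis m A B \<longleftrightarrow>
        B = {1, g} \<union> {monom 1 (i * n) | i. 2 \<le> i \<and> i * n < m - 1}" for B
      unfolding A is_canonical_basis_coeff_alg[OF n ndvd] monoms g setcompr_eq_image image_image
      by simp
    show "Aut_generated_by_root A l" if "CHAR('a) = 0"
      unfolding A using n ndvd l that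
      by (intro Aut_generated_by_root_coeff_alg) (auto simp: of_nat_eq_0_iff_char_dvd)
    show "Aut_generated_by_root A (coprime_part p l)" if p: "CHAR('a) = p \<and> p > 0" for p
    proof -
      have "prime p"
        using prime_CHAR_semidom[where 'a = 'a] p by simp
      note cop = coprime_part[OF this, of l]
      \<comment> \<open>The l-th roots of unity are those of the p-free part of \<open>l\<close>,
        and this part is nonzero in K because \<open>p\<close> does not divide it.\<close>
      have "\<mu> ^ l = 1 \<longleftrightarrow> \<mu> ^ coprime_part p l = 1" for \<mu> :: 'a
        using power_CHAR_power_eq_1_iff[of p \<mu> "multiplicity p l" "coprime_part p l"] p cop(1) l(1)
        by simp
      then show ?thesis
        unfolding A using n ndvd l p cop(2)
        by (intro Aut_generated_by_root_coeff_alg) (auto simp: of_nat_eq_0_iff_char_dvd)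
    qed
  qed
  ultimately show ?thesis
    unfolding n_def[symmetric] less by blast
qed

end
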